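(* Let $m,n\ge1$, $d=m+n$, $\Theta\in\mathbb{R}^{n\times m}$, and weights $\boldsymbol\sigma\in\mathbb{R}^m$, $\boldsymbol\rho\in\mathbb{R}^n$ with $\sigma_1\ge\dots\ge\sigma_m>0$, $\rho_1\ge\dots\ge\rho_n>0$, $\sum\sigma_j=\sum\rho_i=1$. For every $k\in\{1,\dots,d\}$, \[ \omega^{(k)}_{\boldsymbol\sigma,\boldsymbol\rho}(\Theta)\cdot\hat\omega^{(d+1-k)}_{\boldsymbol\rho,\boldsymbol\sigma}({}^t\Theta)=1,\qquad \hat\omega^{(k)}_{\boldsymbol\sigma,\boldsymbol\rho}(\Theta)\cdot\omega^{(d+1-k)}_{\boldsymbol\rho,\boldsymbol\sigma}({}^t\Theta)=1, \] where it is understood that if one of the factors is zero then the other is $+\infty$, and vice versa.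
   Context: For $\mathbf x\in\mathbb{R}^m$, $|\mathbf x|_{\boldsymbol\sigma}=\max_j|x_j|^{1/\sigma_j}$; for $\mathbf y\in\mathbb{R}^n$, $|\mathbf y|_{\boldsymbol\rho}=\max_i|y_i|^{1/\rho_i}$. $\omega^{(k)}_{\boldsymbol\sigma,\boldsymbol\rho}(\Theta)$ (resp. $\hat\omega^{(k)}_{\boldsymbol\sigma,\boldsymbol\rho}(\Theta)$) is the supremum of real $\gamma$ such that the system $|\mathbf x|_{\boldsymbol\sigma}\le t$, $|\Theta\mathbf x-\mathbf y|_{\boldsymbol\rho}\le t^{-\gamma}$ admits $k$ linearly independent solutions $(\mathbf x,\mathbf y)\in\mathbb{Z}^{m+n}$ for some arbitrarily large $t$ (resp. for every $t$ large enough). $\omega^{(k)}_{\boldsymbol\rho,\boldsymbol\sigma}({}^t\Theta)$ (resp. $\hat\omega^{(k)}_{\boldsymbol\rho,\boldsymbol\sigma}({}^t\Theta)$) is the supremum of real $\delta$ such that the system $|\mathbf y|_{\boldsymbol\rho}\le t$, $|{}^t\Theta\mathbf y-\mathbf x|_{\boldsymbol\sigma}\le t^{-\delta}$ admits $k$ linearly independent solutions $(\mathbf x,\mathbf y)\in\mathbb{Z}^{m+n}$ for some arbitrarily large $t$ (resp. for every $t$ large enough). *)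

theory Defs
  imports "HOL-Analysis.Analysis"
begin

definition weighted_norm :: "real ^ 'n \<Rightarrow> real ^ 'n \<Rightarrow> real" where
  "weighted_norm w x = Max (range (\<lambda>i. \<bar>x $ i\<bar> powr (1 / w $ i)))"

definition int_vectors :: "(real ^ 'n) set" where
  "int_vectors = {x. \<forall>i. x $ i \<in> \<int>}"

definition approx_solutions ::
  "real ^ 'm \<Rightarrow> real ^ 'n \<Rightarrow> real ^ 'm ^ 'n \<Rightarrow> real \<Rightarrow> real \<Rightarrow> ((real ^ 'm) \<times> (real ^ 'n)) set" where
  "approx_solutions \<sigma> \<rho> \<Theta> \<gamma> t =
     {(x, y). x \<in> int_vectors \<and> y \<in> int_vectors \<and>
        weighted_norm \<sigma> x \<le> t \<and> weighted_norm \<rho> (\<Theta> *v x - y) \<le> t powr (- \<gamma>)}"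

definition has_independent_solutions ::
  "nat \<Rightarrow> real ^ 'm \<Rightarrow> real ^ 'n \<Rightarrow> real ^ 'm ^ 'n \<Rightarrow> real \<Rightarrow> real \<Rightarrow> bool" where
  "has_independent_solutions k \<sigma> \<rho> \<Theta> \<gamma> t \<longleftrightarrow>
     (\<exists>S. S \<subseteq> approx_solutions \<sigma> \<rho> \<Theta> \<gamma> t \<and> finite S \<and> card S = k \<and> independent S)"

text \<open>The suprema are taken in the extended reals, since the exponents may be infinite.
  The exponents of the transposed system are those of \<^term>\<open>transpose \<Theta>\<close> with the two weights
  exchanged; its solutions are then the pairs \<open>(y, x)\<close> instead of \<open>(x, y)\<close>, which does not
  affect linear independence.\<close>

definition omega_exp :: "nat \<Rightarrow> real ^ 'm \<Rightarrow> real ^ 'n \<Rightarrow> real ^ 'm ^ 'n \<Rightarrow> ereal" where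
  "omega_exp k \<sigma> \<rho> \<Theta> =
     Sup {ereal \<gamma> | \<gamma>. \<exists>\<^sub>F t in at_top. has_independent_solutions k \<sigma> \<rho> \<Theta> \<gamma> t}"

definition omega_hat_exp :: "nat \<Rightarrow> real ^ 'm \<Rightarrow> real ^ 'n \<Rightarrow> real ^ 'm ^ 'n \<Rightarrow> ereal" where
  "omega_hat_exp k \<sigma> \<rho> \<Theta> =
     Sup {ereal \<gamma> | \<gamma>. \<forall>\<^sub>F t in at_top. has_independent_solutions k \<sigma> \<rho> \<Theta> \<gamma> t}"

text \<open>The relation \<open>a \<cdot> b = 1\<close> with the convention that \<open>0\<close> and \<open>+\<infinity>\<close> are reciprocal to each
  other; in \<^typ>\<open>ereal\<close> itself \<open>0 * \<infinity> = 0\<close>.\<close>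

definition product_one :: "ereal \<Rightarrow> ereal \<Rightarrow> bool" where
  "product_one a b \<longleftrightarrow> a * b = 1 \<or> (a = 0 \<and> b = \<infinity>) \<or> (a = \<infinity> \<and> b = 0)"

end

theory Submission
  imports Defs
begin

text \<open>
  For $s = t^\gamma$ the systems with parameters $(\gamma, t)$ and $(1/\gamma, s)$ describe the points
  of a lattice and of its dual lattice in the unit box, so the theorem compares the $k$-th minimum of
  a lattice with the $(d+1-k)$-th minimum of the dual one. Their product is bounded below because
  $k + (d+1-k) > d$ forces a nonzero, hence at least $1$ in absolute value, integral pairing.
  It is bounded above because every lattice has a basis $b_i$ with dual basis $c_i$ such that
  $|b_i| |c_i|$ is bounded in terms of the dimension only: take an almost shortest vector $b$, a basis
  of this kind for the projection of the lattice orthogonal to $b$, and lift it with coefficients of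
  $b$ at most $1/2$ in absolute value. Constant factors are absorbed by changing the exponent slightly.
\<close>

section \<open>Subgroups of a real vector space and almost shortest vectors\<close>

lemma int_multiple_mem_subgroup:
  fixes L :: "'a::real_vector set"
  assumes "0 \<in> L" "\<And>x y. x \<in> L \<Longrightarrow> y \<in> L \<Longrightarrow> x - y \<in> L" "v \<in> L"
  shows "of_int k *\<^sub>R v \<in> L"
proof (induction k rule: int_induct[where k = 0])
  case base
  then show ?case using assms by simp
next
  case (step1 i)
  have "0 - v \<in> L" using assms by blast
  then have "of_int i *\<^sub>R v - (0 - v) \<in> L" using step1 assms by blast
  then show ?case by (simp add: algebra_simps)
next
  case (step2 i)
  have "of_int i *\<^sub>R v - v \<in> L" using step2 assms by blast
  then show ?case by (simp add: algebra_simps)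
qed

lemma sum_mem_subgroup:
  fixes L :: "'a::ab_group_add set"
  assumes "0 \<in> L" "\<And>x y. x \<in> L \<Longrightarrow> y \<in> L \<Longrightarrow> x - y \<in> L"
    and "\<And>i. i \<in> I \<Longrightarrow> f i \<in> L"
  shows "sum f I \<in> L"
  using assms(3)
proof (induction I rule: infinite_finite_induct)
  case (insert i I)
  have "0 - f i \<in> L" "sum f I \<in> L" using assms insert by blast+
  then have "sum f I - (0 - f i) \<in> L" using assms(2) by blast
  then show ?case using insert by (simp add: add.commute)
qed (use assms in auto)

text \<open>The infimum of the nonzero norms is positive, hence strictly smaller than
  \<open>sqrt 2\<close> times itself, and some norm lies below the larger value. Accepting the
  factor 2 avoids having to show that the infimum is attained.\<close>

lemma ex_near_shortest_vector:
  fixes L :: "'a::real_normed_vector set"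
  assumes "0 < e" "\<And>v. v \<in> L \<Longrightarrow> v \<noteq> 0 \<Longrightarrow> e \<le> norm v" "u \<in> L" "u \<noteq> 0"
  obtains b where "b \<in> L" "b \<noteq> 0" "\<And>v. v \<in> L \<Longrightarrow> v \<noteq> 0 \<Longrightarrow> (norm b)\<^sup>2 \<le> 2 * (norm v)\<^sup>2"
proof -
  define N where "N = norm ` (L - {0})"
  have ne: "N \<noteq> {}" and bdd: "bdd_below N"
    using assms unfolding N_def by (auto intro: bdd_belowI2[where m = 0])
  have "e \<le> Inf N" using ne assms by (auto simp: N_def intro!: cInf_greatest)
  then have pos: "0 < Inf N" using assms(1) by linarith
  then have "Inf N < sqrt 2 * Inf N" by simp
  then obtain y where y: "y \<in> N" "y < sqrt 2 * Inf N" using cInf_lessD[OF ne] by blast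
  then obtain b where b: "b \<in> L" "b \<noteq> 0" "norm b < sqrt 2 * Inf N" by (auto simp: N_def)
  have "(norm b)\<^sup>2 \<le> 2 * (norm v)\<^sup>2" if "v \<in> L" "v \<noteq> 0" for v
  proof -
    have "Inf N \<le> norm v" using that bdd by (auto simp: N_def intro: cInf_lower)
    then have "norm b \<le> sqrt 2 * norm v" using b(3)
      by (meson less_eq_real_def order_trans mult_left_mono real_sqrt_ge_zero zero_le_numeral)
    then have "(norm b)\<^sup>2 \<le> (sqrt 2 * norm v)\<^sup>2" by (simp add: power_mono)
    then show ?thesis by (simp add: power_mult_distrib)
  qed
  with b that show ?thesis by blast
qed

section \<open>Reduced bases of discrete subgroups, with their dual bases\<close>

definition discrete_subgroup :: "'a::real_normed_vector set \<Rightarrow> bool" where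
  "discrete_subgroup L \<longleftrightarrow> 0 \<in> L \<and> (\<forall>x\<in>L. \<forall>y\<in>L. x - y \<in> L) \<and>
     (\<exists>e>0. \<forall>v\<in>L. v \<noteq> 0 \<longrightarrow> e \<le> norm v)"

text \<open>Here \<open>r\<close> is the rank and \<open>c\<close> the dual basis of
  \<open>b\<close> inside the span. Integrality of all \<open>v \<bullet> c i\<close> makes
  \<open>b\<close> a basis over the integers and not only of the span; later it places the
  \<open>c i\<close> in the dual lattice.\<close>

definition has_reduced_basis :: "'a::real_inner set \<Rightarrow> nat \<Rightarrow> real \<Rightarrow> bool" where
  "has_reduced_basis L n C \<longleftrightarrow> (\<exists>r b c. r \<le> n \<and>
     (\<forall>i<r. b i \<in> L \<and> c i \<in> span L \<and> norm (b i) * norm (c i) \<le> C) \<and>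
     (\<forall>i<r. \<forall>j<r. b i \<bullet> c j = (if i = j then 1 else 0)) \<and>
     (\<forall>v\<in>L. (\<forall>i<r. v \<bullet> c i \<in> \<int>) \<and> v = (\<Sum>i<r. (v \<bullet> c i) *\<^sub>R b i)))"

lemma has_reduced_basisE:
  assumes "has_reduced_basis L n C"
  obtains r b c where "r \<le> n" "\<And>i. i < r \<Longrightarrow> b i \<in> L" "\<And>i. i < r \<Longrightarrow> c i \<in> span L"
    "\<And>i. i < r \<Longrightarrow> norm (b i) * norm (c i) \<le> C"
    "\<And>i j. i < r \<Longrightarrow> j < r \<Longrightarrow> b i \<bullet> c j = (if i = j then 1 else 0)"
    "\<And>v i. v \<in> L \<Longrightarrow> i < r \<Longrightarrow> v \<bullet> c i \<in> \<int>"
    "\<And>v. v \<in> L \<Longrightarrow> v = (\<Sum>i<r. (v \<bullet> c i) *\<^sub>R b i)"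
proof -
  obtain r b c where *: "r \<le> n"
    "\<forall>i<r. b i \<in> L \<and> c i \<in> span L \<and> norm (b i) * norm (c i) \<le> C"
    "\<forall>i<r. \<forall>j<r. b i \<bullet> c j = (if i = j then 1 else 0)"
    "\<forall>v\<in>L. (\<forall>i<r. v \<bullet> c i \<in> \<int>) \<and> v = (\<Sum>i<r. (v \<bullet> c i) *\<^sub>R b i)"
    using assms unfolding has_reduced_basis_def by blast
  show thesis by (rule that[of r b c]) (use * in blast)+
qed

text \<open>The dual vectors \<open>c'\<close> of the projected lattice are orthogonal to
  \<open>b1\<close> and are kept, so only the lifts \<open>b\<close> of \<open>b'\<close> and one
  new dual vector \<open>cr\<close> have to be controlled. Lifting at most doubles a norm, which
  gives products at most \<open>2 * C\<close>; the pair \<open>b1\<close>, \<open>cr\<close> costs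
  at most \<open>1 + real n * C\<close>. The constant is the sum of both.\<close>

lemma has_reduced_basis_step:
  fixes L :: "'a::euclidean_space set"
  assumes IH: "\<And>L'::'a set. discrete_subgroup L' \<Longrightarrow> dim L' \<le> n \<Longrightarrow> has_reduced_basis L' n C"
    and "0 \<le> C" and L: "discrete_subgroup L" and dim: "dim L \<le> Suc n"
    and u: "u \<in> L" "u \<noteq> 0"
  shows "has_reduced_basis L (Suc n) (2 * C + real n * C + 1)"
proof -
  have L0: "0 \<in> L" and Ldiff: "\<And>x y. x \<in> L \<Longrightarrow> y \<in> L \<Longrightarrow> x - y \<in> L"
    using L by (auto simp: discrete_subgroup_def)
  obtain b1 where b1: "b1 \<in> L" "b1 \<noteq> 0"
    and short: "\<And>v. v \<in> L \<Longrightarrow> v \<noteq> 0 \<Longrightarrow> (norm b1)\<^sup>2 \<le> 2 * (norm v)\<^sup>2"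
    using L u ex_near_shortest_vector unfolding discrete_subgroup_def by metis
  define \<mu> where "\<mu> v = (v \<bullet> b1) / (b1 \<bullet> b1)" for v
  define P where "P v = v - \<mu> v *\<^sub>R b1" for v
  have Pb: "P v \<bullet> b1 = 0" for v using b1 by (simp add: P_def \<mu>_def inner_diff_left)
  have \<mu>_b1: "\<mu> b1 = 1" using b1 by (simp add: \<mu>_def)
  have \<mu>_diff: "\<mu> (x - y) = \<mu> x - \<mu> y" and \<mu>_scale: "\<mu> (s *\<^sub>R x) = s * \<mu> x" for x y s
    by (simp_all add: \<mu>_def inner_diff_left diff_divide_distrib)
  have P_diff: "P (x - y) = P x - P y" for x y by (simp add: P_def \<mu>_diff algebra_simps)
  have decomp: "v = P v + \<mu> v *\<^sub>R b1" for v by (simp add: P_def)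
  have pyth: "(norm v)\<^sup>2 = (norm (P v))\<^sup>2 + (\<mu> v)\<^sup>2 * (norm b1)\<^sup>2" for v
  proof -
    have "orthogonal (P v) (\<mu> v *\<^sub>R b1)" using Pb by (simp add: orthogonal_def)
    then show ?thesis
      using norm_add_Pythagorean decomp[of v] by (metis norm_scaleR power2_abs power_mult_distrib)
  qed
  \<comment> \<open>Rounding \<open>\<mu> v\<close> subtracts an integral multiple of
    \<open>b1\<close>, which stays in the lattice and does not change the projection.\<close>
  have lift: "\<exists>w\<in>L. P w = P v \<and> \<bar>\<mu> w\<bar> \<le> 1/2" if "v \<in> L" for v
  proof -
    define w where "w = v - of_int (round (\<mu> v)) *\<^sub>R b1"
    have "w \<in> L" unfolding w_def
      using Ldiff int_multiple_mem_subgroup[OF L0 Ldiff b1(1)] that by blast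
    moreover have mw: "\<mu> w = \<mu> v - of_int (round (\<mu> v))" by (simp add: w_def \<mu>_diff \<mu>_scale \<mu>_b1)
    then have "P w = P v" unfolding P_def mw by (simp add: w_def algebra_simps)
    moreover have "\<bar>\<mu> w\<bar> \<le> 1/2" using mw of_int_round_abs_le[of "\<mu> v"] by (simp add: abs_minus_commute)
    ultimately show ?thesis by blast
  qed
  have sq: "(\<mu> w)\<^sup>2 \<le> 1/4" if "\<bar>\<mu> w\<bar> \<le> 1/2" for w
    using power_mono[OF that, of 2] by (simp add: power_divide)
  \<comment> \<open>A short projection would have a lift \<open>w\<close> that is too short compared
    with \<open>b1\<close>: the part of \<open>w\<close> along \<open>b1\<close> accounts for at
    most half of the squared norm of \<open>b1\<close>, and the other half is bounded by
    \<open>2 * (norm (P v))\<^sup>2\<close>. This bound makes the projected lattice discrete and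
    compares \<open>b1\<close> with every \<open>b' i\<close>.\<close>
  have P_lower: "norm b1 \<le> 2 * norm (P v)" if "w \<in> L" "P w = P v" "\<bar>\<mu> w\<bar> \<le> 1/2" "P v \<noteq> 0" for v w
  proof -
    have "w \<noteq> 0" using that by (auto simp: P_def \<mu>_def)
    then have "(norm b1)\<^sup>2 \<le> 2 * (norm w)\<^sup>2" using short that by blast
    also have "\<dots> = 2 * (norm (P v))\<^sup>2 + 2 * ((\<mu> w)\<^sup>2 * (norm b1)\<^sup>2)" using pyth[of w] that by simp
    also have "(\<mu> w)\<^sup>2 * (norm b1)\<^sup>2 \<le> 1/4 * (norm b1)\<^sup>2"
      using sq that by (intro mult_right_mono) auto
    finally have "(norm b1)\<^sup>2 \<le> (2 * norm (P v))\<^sup>2" by (simp add: power_mult_distrib)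
    then show ?thesis by (rule power2_le_imp_le) simp
  qed
  \<comment> \<open>\<open>b1\<close> is primitive: the remainder after rounding is a lattice vector
    with at most a quarter of the squared norm of \<open>b1\<close>, whereas near minimality demands
    at least half unless it vanishes.\<close>
  have axis_int: "s \<in> \<int>" if "s *\<^sub>R b1 \<in> L" for s
  proof -
    define w' where "w' = (s - of_int (round s)) *\<^sub>R b1"
    have "w' \<in> L" using Ldiff[OF that int_multiple_mem_subgroup[OF L0 Ldiff b1(1), of "round s"]]
      by (simp add: w'_def algebra_simps)
    have "\<bar>s - of_int (round s)\<bar> \<le> 1/2" using of_int_round_abs_le[of s] by (simp add: abs_minus_commute)
    then have le: "(s - of_int (round s))\<^sup>2 \<le> 1/4"
      using power_mono[of "\<bar>s - of_int (round s)\<bar>" "1/2" 2] by (simp add: power_divide)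
    have "w' = 0"
    proof (rule ccontr)
      assume "w' \<noteq> 0"
      then have "(norm b1)\<^sup>2 \<le> 2 * (norm w')\<^sup>2" using short \<open>w' \<in> L\<close> by blast
      also have "\<dots> = 2 * ((s - of_int (round s))\<^sup>2 * (norm b1)\<^sup>2)"
        by (simp add: w'_def power_mult_distrib)
      also have "(s - of_int (round s))\<^sup>2 * (norm b1)\<^sup>2 \<le> 1/4 * (norm b1)\<^sup>2"
        using le by (intro mult_right_mono) auto
      finally show False using b1 by simp
    qed
    then have "s = of_int (round s)" using b1 by (simp add: w'_def)
    then show ?thesis by (metis Ints_of_int)
  qed
  define L' where "L' = P ` L"
  have L'_orth: "x \<bullet> b1 = 0" if "x \<in> span L'" for x
    using that by (induction rule: span_induct_alt) (auto simp: L'_def Pb inner_add_left)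
  have L'_sub: "span L' \<subseteq> span L"
    by (rule span_minimal) (auto simp: L'_def P_def intro!: span_diff span_scale intro: span_base b1)
  \<comment> \<open>\<open>b1\<close> lies in \<open>span L\<close> but is orthogonal to
    \<open>span L'\<close>, so the projection loses a dimension and the induction hypothesis
    applies.\<close>
  have "b1 \<notin> span L'" using L'_orth[of b1] b1 by auto
  then have "span L' \<subset> span L" using L'_sub b1(1) span_base by blast
  then have "dim L' < dim L" by (rule dim_psubset)
  then have "dim L' \<le> n" using dim by linarith
  moreover have "discrete_subgroup L'"
  proof -
    have "P 0 = 0" by (simp add: P_def \<mu>_def)
    then have "0 \<in> L'" using L0 unfolding L'_def by force
    moreover have "x - y \<in> L'" if "x \<in> L'" "y \<in> L'" for x y
      using that Ldiff P_diff unfolding L'_def by (metis (no_types, lifting) image_iff)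
    moreover have "norm b1 / 2 \<le> norm x" if "x \<in> L'" "x \<noteq> 0" for x
    proof -
      obtain v where "v \<in> L" "x = P v" using \<open>x \<in> L'\<close> unfolding L'_def by blast
      then show ?thesis using lift[of v] P_lower[of _ v] that by fastforce
    qed
    moreover have "norm b1 / 2 > 0" using b1 by simp
    ultimately show ?thesis unfolding discrete_subgroup_def by blast
  qed
  ultimately have "has_reduced_basis L' n C" using IH by blast
  then obtain r b' c' where rn: "r \<le> n"
    and b': "\<And>i. i < r \<Longrightarrow> b' i \<in> L'" and c': "\<And>i. i < r \<Longrightarrow> c' i \<in> span L'"
    and nb: "\<And>i. i < r \<Longrightarrow> norm (b' i) * norm (c' i) \<le> C"
    and bi: "\<And>i j. i < r \<Longrightarrow> j < r \<Longrightarrow> b' i \<bullet> c' j = (if i = j then 1 else 0)"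
    and int': "\<And>v i. v \<in> L' \<Longrightarrow> i < r \<Longrightarrow> v \<bullet> c' i \<in> \<int>"
    and exp': "\<And>v. v \<in> L' \<Longrightarrow> v = (\<Sum>i<r. (v \<bullet> c' i) *\<^sub>R b' i)"
    using has_reduced_basisE by blast
  have "\<forall>i. \<exists>w. i < r \<longrightarrow> w \<in> L \<and> P w = b' i \<and> \<bar>\<mu> w\<bar> \<le> 1/2"
    using b' lift unfolding L'_def by fastforce
  then obtain b where bL: "\<And>i. i < r \<Longrightarrow> b i \<in> L" and Pbi: "\<And>i. i < r \<Longrightarrow> P (b i) = b' i"
    and \<mu>b: "\<And>i. i < r \<Longrightarrow> \<bar>\<mu> (b i)\<bar> \<le> 1/2" by metis
  have c'b1: "b1 \<bullet> c' j = 0" if "j < r" for j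
    using L'_orth[OF c'[OF that]] by (simp add: inner_commute)
  have dot: "P v \<bullet> c' j = v \<bullet> c' j" if "j < r" for v j
    using c'b1[OF that] by (simp add: P_def inner_diff_left)
  have b'0: "b' i \<noteq> 0" if "i < r" for i using bi[OF that that] by auto
  have b1_le: "norm b1 \<le> 2 * norm (b' i)" if "i < r" for i
    using P_lower[of "b i" "b i"] bL Pbi \<mu>b b'0 that by simp
  have b_le: "norm (b i) \<le> 2 * norm (b' i)" if "i < r" for i
  proof -
    have "(norm (b i))\<^sup>2 \<le> (norm (b' i))\<^sup>2 + 1/4 * (norm b1)\<^sup>2"
      using pyth[of "b i"] Pbi that mult_right_mono[OF sq[OF \<mu>b[OF that]], of "(norm b1)\<^sup>2"] by simp
    also have "(norm b1)\<^sup>2 \<le> (2 * norm (b' i))\<^sup>2" using b1_le[OF that] by (rule power_mono) simp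
    finally have "(norm (b i))\<^sup>2 \<le> 2 * (norm (b' i))\<^sup>2" by (simp add: power_mult_distrib)
    also have "\<dots> \<le> (2 * norm (b' i))\<^sup>2" by (simp add: power_mult_distrib)
    finally show ?thesis by (rule power2_le_imp_le) simp
  qed
  \<comment> \<open>The functional \<open>\<mu>\<close> is corrected by the \<open>c' i\<close> so
    that it vanishes on every lift \<open>b i\<close>. It still takes the value 1 at
    \<open>b1\<close>, which is orthogonal to all \<open>c' i\<close>.\<close>
  define cr where "cr = (1 / (b1 \<bullet> b1)) *\<^sub>R b1 - (\<Sum>i<r. \<mu> (b i) *\<^sub>R c' i)"
  have dot_cr: "v \<bullet> cr = \<mu> v - (\<Sum>i<r. (v \<bullet> c' i) * \<mu> (b i))" for v
    by (simp add: cr_def inner_diff_right inner_sum_right \<mu>_def mult.commute)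
  have bic: "b i \<bullet> c' j = (if i = j then 1 else 0)" if "i < r" "j < r" for i j
    using dot[OF that(2), of "b i"] Pbi[OF that(1)] bi[OF that] by simp
  have expand: "v = (\<Sum>i<r. (v \<bullet> c' i) *\<^sub>R b i) + (v \<bullet> cr) *\<^sub>R b1" if "v \<in> L" for v
  proof -
    have "P v = (\<Sum>i<r. (v \<bullet> c' i) *\<^sub>R b' i)"
      using exp'[of "P v"] that dot by (simp add: L'_def)
    also have "\<dots> = (\<Sum>i<r. (v \<bullet> c' i) *\<^sub>R (b i - \<mu> (b i) *\<^sub>R b1))"
      using Pbi by (intro sum.cong) (auto simp: P_def)
    also have "\<dots> = (\<Sum>i<r. (v \<bullet> c' i) *\<^sub>R b i) - (\<Sum>i<r. (v \<bullet> c' i) * \<mu> (b i)) *\<^sub>R b1"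
      by (simp add: scaleR_diff_right sum_subtractf scaleR_sum_left)
    finally show ?thesis unfolding P_def by (simp add: dot_cr algebra_simps)
  qed
  have int_c': "v \<bullet> c' i \<in> \<int>" if "v \<in> L" "i < r" for v i
    using int'[of "P v" i] that dot by (simp add: L'_def)
  \<comment> \<open>Removing the integral combination of the \<open>b i\<close> from
    \<open>v\<close> leaves a lattice point on the line of \<open>b1\<close>, to which
    \<open>axis_int\<close> applies.\<close>
  have int_cr: "v \<bullet> cr \<in> \<int>" if "v \<in> L" for v
  proof -
    have "(v \<bullet> c' i) *\<^sub>R b i \<in> L" if "i < r" for i
      using int_multiple_mem_subgroup[OF L0 Ldiff bL[OF that]] int_c'[OF \<open>v \<in> L\<close> that]
      by (metis Ints_cases)
    then have "(\<Sum>i<r. (v \<bullet> c' i) *\<^sub>R b i) \<in> L" by (intro sum_mem_subgroup[OF L0 Ldiff]) auto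
    then have "(v \<bullet> cr) *\<^sub>R b1 \<in> L"
      using Ldiff[OF that] expand[OF that] by (metis add_diff_cancel_left')
    then show ?thesis by (rule axis_int)
  qed
  have cr_span: "cr \<in> span L"
    unfolding cr_def using b1 c' L'_sub by (intro span_diff span_scale span_sum) (auto intro: span_base)
  \<comment> \<open>The first summand of \<open>cr\<close> has norm \<open>1 / norm b1\<close>. Each
    of the others has norm at most half of \<open>norm (c' i)\<close>, and
    \<open>norm b1 \<le> 2 * norm (b' i)\<close> bounds its product with \<open>norm b1\<close> by
    \<open>C\<close>.\<close>
  have cr_norm: "norm b1 * norm cr \<le> 1 + real n * C"
  proof -
    have "norm cr \<le> 1 / norm b1 + norm (\<Sum>i<r. \<mu> (b i) *\<^sub>R c' i)"
      unfolding cr_def by (rule order_trans[OF norm_triangle_ineq4])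
        (use b1 in \<open>simp add: dot_square_norm power2_eq_square\<close>)
    also have "norm (\<Sum>i<r. \<mu> (b i) *\<^sub>R c' i) \<le> (\<Sum>i<r. 1/2 * norm (c' i))"
    proof (rule sum_norm_le)
      fix i assume "i \<in> {..<r}"
      then show "norm (\<mu> (b i) *\<^sub>R c' i) \<le> 1/2 * norm (c' i)"
        unfolding norm_scaleR using \<mu>b by (intro mult_right_mono) auto
    qed
    finally have "norm b1 * norm cr \<le> norm b1 * (1 / norm b1 + (\<Sum>i<r. 1/2 * norm (c' i)))"
      by (intro mult_left_mono) auto
    also have "\<dots> = 1 + (\<Sum>i<r. norm b1 * (1/2 * norm (c' i)))"
      using b1 by (simp add: distrib_left sum_distrib_left)
    also have "(\<Sum>i<r. norm b1 * (1/2 * norm (c' i))) \<le> (\<Sum>i<r. C)"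
    proof (rule sum_mono)
      fix i assume "i \<in> {..<r}"
      then have "norm b1 * norm (c' i) \<le> 2 * norm (b' i) * norm (c' i)"
        using b1_le by (intro mult_right_mono) auto
      also have "\<dots> \<le> 2 * C" using nb \<open>i \<in> {..<r}\<close> by simp
      finally show "norm b1 * (1/2 * norm (c' i)) \<le> C" by simp
    qed
    also have "(\<Sum>i<r. C) \<le> real n * C" using rn \<open>0 \<le> C\<close> by (simp add: mult_right_mono)
    finally show ?thesis by simp
  qed
  define B where "B = b(r := b1)"
  define D where "D = c'(r := cr)"
  have "\<forall>i<Suc r. B i \<in> L \<and> D i \<in> span L \<and> norm (B i) * norm (D i) \<le> 2 * C + real n * C + 1"
  proof (intro allI impI)
    fix i assume i: "i < Suc r"
    show "B i \<in> L \<and> D i \<in> span L \<and> norm (B i) * norm (D i) \<le> 2 * C + real n * C + 1"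
    proof (cases "i = r")
      case True
      then show ?thesis using b1 cr_span cr_norm \<open>0 \<le> C\<close> by (simp add: B_def D_def)
    next
      case False
      with i have "i < r" by simp
      then have "norm (b i) * norm (c' i) \<le> 2 * norm (b' i) * norm (c' i)"
        using b_le by (intro mult_right_mono) auto
      also have "\<dots> \<le> 2 * C" using nb[OF \<open>i < r\<close>] by simp
      finally have "norm (b i) * norm (c' i) \<le> 2 * C + real n * C + 1" using \<open>0 \<le> C\<close>
        by (smt (verit) mult_nonneg_nonneg of_nat_0_le_iff)
      then show ?thesis using False bL c' L'_sub \<open>i < r\<close> by (auto simp: B_def D_def)
    qed
  qed
  moreover have "b i \<bullet> cr = 0" if "i < r" for i
  proof -
    have "(\<Sum>j<r. (b i \<bullet> c' j) * \<mu> (b j)) = (\<Sum>j<r. if i = j then \<mu> (b j) else 0)"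
      using bic[OF that] by (intro sum.cong) auto
    then show ?thesis using that by (simp add: dot_cr)
  qed
  then have "\<forall>i<Suc r. \<forall>j<Suc r. B i \<bullet> D j = (if i = j then 1 else 0)"
    using bic c'b1 dot_cr[of b1] \<mu>_b1 by (auto simp: B_def D_def less_Suc_eq)
  moreover have "\<forall>v\<in>L. (\<forall>i<Suc r. v \<bullet> D i \<in> \<int>) \<and> v = (\<Sum>i<Suc r. (v \<bullet> D i) *\<^sub>R B i)"
    using expand int_c' int_cr by (auto simp: B_def D_def less_Suc_eq)
  moreover have "Suc r \<le> Suc n" using rn by simp
  ultimately show ?thesis unfolding has_reduced_basis_def
    by - (rule exI[of _ "Suc r"], rule exI[of _ B], rule exI[of _ D], intro conjI)
qed

text \<open>The step is iterated from the constant 0 in dimension 0. The constant is chosen before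
  the lattice, which is essential because the lattices used later vary with t.\<close>

lemma ex_reduced_basis_const:
  "\<exists>C\<ge>0. \<forall>L::'a::euclidean_space set. discrete_subgroup L \<longrightarrow> dim L \<le> n \<longrightarrow> has_reduced_basis L n C"
proof (induction n)
  case 0
  have "has_reduced_basis L 0 0" if "discrete_subgroup L" "dim L \<le> 0" for L :: "'a set"
    using that unfolding has_reduced_basis_def by (intro exI[of _ 0]) (auto simp: dim_eq_0)
  then show ?case by blast
next
  case (Suc n)
  then obtain C where C: "0 \<le> C"
    "\<And>L::'a set. discrete_subgroup L \<Longrightarrow> dim L \<le> n \<Longrightarrow> has_reduced_basis L n C" by blast
  have "has_reduced_basis L (Suc n) (2 * C + real n * C + 1)"
    if L: "discrete_subgroup L" "dim L \<le> Suc n" for L :: "'a set"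
  proof (cases "L \<subseteq> {0}")
    case True
    then show ?thesis unfolding has_reduced_basis_def by (intro exI[of _ 0]) auto
  next
    case False
    then show ?thesis using has_reduced_basis_step[OF C(2,1) L] by blast
  qed
  moreover have "0 \<le> 2 * C + real n * C + 1" using C(1) by simp
  ultimately show ?case by blast
qed

section \<open>Integral points in boxes and the pairing of a system with its transpose\<close>

text \<open>Weights and exponents will enter only through the side lengths \<open>a\<close> and
  \<open>q\<close>, as powers of t; with arbitrary sides the geometry of numbers is separated from
  them.\<close>

definition box_solutions :: "real ^ 'm \<Rightarrow> real ^ 'n \<Rightarrow> real ^ 'm ^ 'n \<Rightarrow> ((real ^ 'm) \<times> (real ^ 'n)) set" where
  "box_solutions a q \<Theta> = {(x, y). x \<in> int_vectors \<and> y \<in> int_vectors \<and>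
     (\<forall>j. \<bar>x $ j\<bar> \<le> a $ j) \<and> (\<forall>i. \<bar>(\<Theta> *v x - y) $ i\<bar> \<le> q $ i)}"

lemma inner_int_vectors: "x \<in> int_vectors \<Longrightarrow> y \<in> int_vectors \<Longrightarrow> x \<bullet> y \<in> \<int>"
  by (auto simp: int_vectors_def inner_vec_def intro!: Ints_sum Ints_mult)

lemma inner_matrix_transpose:
  fixes \<Theta> :: "real ^ 'm ^ 'n"
  shows "x \<bullet> (transpose \<Theta> *v y) = (\<Theta> *v x) \<bullet> y"
  by (simp add: dot_lmul_matrix inner_commute[of x] inner_commute[of _ y])

text \<open>The two terms containing \<open>\<Theta>\<close> cancel by adjointness. The left side
  consists of products of quantities bounded by the boxes, while the right side is an integer when
  all four vectors are integral.\<close>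

lemma pairing_eq:
  fixes \<Theta> :: "real ^ 'm ^ 'n"
  shows "x \<bullet> (transpose \<Theta> *v y' - x') - (\<Theta> *v x - y) \<bullet> y' = y \<bullet> y' - x \<bullet> x'"
  by (simp add: inner_diff_left inner_diff_right inner_matrix_transpose del: transpose_matrix_vector)

lemma abs_inner_le:
  fixes x y a b :: "real ^ 'n"
  assumes "\<And>i. \<bar>x $ i\<bar> \<le> a $ i" "\<And>i. \<bar>y $ i\<bar> \<le> b $ i"
  shows "\<bar>x \<bullet> y\<bar> \<le> (\<Sum>i\<in>UNIV. a $ i * b $ i)"
  unfolding inner_vec_def
proof (rule order_trans[OF sum_abs], rule sum_mono)
  fix i
  have "0 \<le> a $ i" using assms(1)[of i] by linarith
  then show "\<bar>x $ i \<bullet> y $ i\<bar> \<le> a $ i * b $ i"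
    using assms by (simp add: abs_mult mult_mono)
qed

text \<open>If the sum were below 1, every pairing would be an integer of absolute value below 1,
  hence 0. The two families would then span orthogonal subspaces whose dimensions add up to more
  than that of the whole space.\<close>

lemma box_solutions_dual_obstruction:
  fixes \<Theta> :: "real ^ 'm ^ 'n"
  assumes S: "S \<subseteq> box_solutions a q \<Theta>" "finite S" "independent S"
    and S': "S' \<subseteq> box_solutions a' q' (transpose \<Theta>)" "finite S'" "independent S'"
    and card: "CARD('m) + CARD('n) < card S + card S'"
  shows "1 \<le> (\<Sum>j\<in>UNIV. a $ j * q' $ j) + (\<Sum>i\<in>UNIV. q $ i * a' $ i)"
proof (rule ccontr)
  assume small: "\<not> ?thesis"
  \<comment> \<open>The sign and the exchange of components turn the pairing
    \<open>y \<bullet> y' - x \<bullet> x'\<close> into the standard inner product.\<close>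
  define \<phi> :: "(real ^ 'n) \<times> (real ^ 'm) \<Rightarrow> (real ^ 'm) \<times> (real ^ 'n)" where "\<phi> = (\<lambda>(y, x). (- x, y))"
  have lin: "linear \<phi>" by (auto simp: \<phi>_def linear_iff)
  have inj: "inj \<phi>" by (auto simp: \<phi>_def inj_def)
  have orth: "orthogonal z (\<phi> z')" if "z \<in> S" "z' \<in> S'" for z z'
  proof -
    obtain x y where z: "z = (x, y)" by force
    obtain y' x' where z': "z' = (y', x')" by force
    have *: "x \<in> int_vectors" "y \<in> int_vectors" "\<And>j. \<bar>x $ j\<bar> \<le> a $ j" "\<And>i. \<bar>(\<Theta> *v x - y) $ i\<bar> \<le> q $ i"
      using that S(1) z by (auto simp: box_solutions_def)
    have **: "x' \<in> int_vectors" "y' \<in> int_vectors" "\<And>i. \<bar>y' $ i\<bar> \<le> a' $ i"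
      "\<And>j. \<bar>(transpose \<Theta> *v y' - x') $ j\<bar> \<le> q' $ j"
      using that S'(1) z' unfolding box_solutions_def by blast+
    have "\<bar>x \<bullet> (transpose \<Theta> *v y' - x')\<bar> \<le> (\<Sum>j\<in>UNIV. a $ j * q' $ j)"
      by (rule abs_inner_le) (rule * **)+
    moreover have "\<bar>(\<Theta> *v x - y) \<bullet> y'\<bar> \<le> (\<Sum>i\<in>UNIV. q $ i * a' $ i)"
      by (rule abs_inner_le) (rule * **)+
    ultimately have "\<bar>y \<bullet> y' - x \<bullet> x'\<bar> < 1" using pairing_eq[of x \<Theta> y' x' y] small by linarith
    moreover have "y \<bullet> y' - x \<bullet> x' \<in> \<int>" using * ** by (intro Ints_diff inner_int_vectors)
    ultimately have "y \<bullet> y' - x \<bullet> x' = 0" using Ints_nonzero_abs_less1 by blast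
    then show ?thesis by (simp add: z z' \<phi>_def orthogonal_def)
  qed
  have "orthogonal z (\<phi> z')" if "z \<in> span S" "z' \<in> S'" for z z'
    using that orth by (meson orthogonal_commute orthogonal_to_span)
  then have "\<phi> ` S' \<subseteq> {y \<in> UNIV. \<forall>x \<in> span S. orthogonal x y}" by auto
  then have "dim (\<phi> ` S') \<le> dim {y \<in> UNIV. \<forall>x \<in> span S. orthogonal x y}" by (rule dim_subset)
  moreover have "dim {y \<in> UNIV. \<forall>x \<in> span S. orthogonal x y} + dim (span S) = dim (UNIV :: ((real ^ 'm) \<times> (real ^ 'n)) set)"
    by (rule dim_subspace_orthogonal_to_vectors) auto
  moreover have "dim (span S) = card S" using S by (simp add: dim_eq_card_independent)
  moreover have "independent (\<phi> ` S')"
    using linear_independent_injective_image[OF lin S'(3)] inj inj_on_subset by blast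
  then have "dim (\<phi> ` S') = card S'"
    using card_image[OF inj_on_subset[OF inj]] by (simp add: dim_eq_card_independent)
  ultimately show False using card by simp
qed

section \<open>Transference between a box and its dual box\<close>

text \<open>Applying \<open>h j\<close> to a linear relation isolates the coefficient of
  \<open>f j\<close>. Injectivity is recorded because the solutions have to be counted.\<close>

lemma independent_if_dual_functionals:
  fixes f :: "nat \<Rightarrow> 'a::real_vector"
  assumes "finite I" "\<And>j. linear (h j)"
    and "\<And>i j. i \<in> I \<Longrightarrow> j \<in> I \<Longrightarrow> h j (f i) = (if i = j then 1 else 0 :: real)"
  shows "inj_on f I" "independent (f ` I)"
proof -
  show inj: "inj_on f I" by (rule inj_onI) (metis assms(3) zero_neq_one)
  show "independent (f ` I)"
  proof (rule independent_if_scalars_zero)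
    fix g x assume sum: "(\<Sum>x\<in>f ` I. g x *\<^sub>R x) = 0" and "x \<in> f ` I"
    then obtain j where j: "j \<in> I" "x = f j" by blast
    have "(\<Sum>i\<in>I. g (f i) *\<^sub>R f i) = 0" using sum by (simp add: sum.reindex[OF inj])
    then have "h j (\<Sum>i\<in>I. g (f i) *\<^sub>R f i) = 0" using linear_0[OF assms(2)] by simp
    moreover have "h j (\<Sum>i\<in>I. g (f i) *\<^sub>R f i) = (\<Sum>i\<in>I. if i = j then g (f j) else 0)"
      unfolding linear_sum[OF assms(2)]
      by (rule sum.cong) (use assms(3) j in \<open>auto simp: linear_cmul[OF assms(2)]\<close>)
    ultimately show "g x = 0" using j assms(1) by simp
  qed (use assms in simp)
qed

text \<open>After the box is scaled to the unit cube, each index of a reduced basis has either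
  \<open>norm (b i) \<le> 1\<close>, giving a point of the first box, or
  \<open>norm (c i) \<le> C\<close>, giving a point of the dual box. There are d = m + n indices, so
  fewer than \<open>k\<close> of the first kind leave at least d + 1 - k of the second.\<close>

lemma ex_transference_const:
  "\<exists>C>0. \<forall>(\<Theta> :: real ^ 'm ^ 'n) a q k.
     (\<forall>j. 0 < a $ j) \<longrightarrow> (\<forall>i. 0 < q $ i) \<longrightarrow> 1 \<le> k \<longrightarrow> k \<le> CARD('m) + CARD('n) \<longrightarrow>
     (\<exists>S \<subseteq> box_solutions a q \<Theta>. finite S \<and> card S = k \<and> independent S) \<or>
     (\<exists>S \<subseteq> box_solutions (\<chi> i. C / q $ i) (\<chi> j. C / a $ j) (transpose \<Theta>).
        finite S \<and> card S = CARD('m) + CARD('n) + 1 - k \<and> independent S)"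
proof -
  obtain C where C: "0 \<le> C" "\<And>L::((real ^ 'm) \<times> (real ^ 'n)) set. discrete_subgroup L \<Longrightarrow>
      dim L \<le> CARD('m) + CARD('n) \<Longrightarrow> has_reduced_basis L (CARD('m) + CARD('n)) C"
    using ex_reduced_basis_const by blast
  \<comment> \<open>Only \<open>0 \<le> C\<close> is known and the claim asks for a positive
    constant, hence \<open>C + 1\<close>.\<close>
  have "(\<exists>S \<subseteq> box_solutions a q \<Theta>. finite S \<and> card S = k \<and> independent S) \<or>
     (\<exists>S \<subseteq> box_solutions (\<chi> i. (C + 1) / q $ i) (\<chi> j. (C + 1) / a $ j) (transpose \<Theta>).
        finite S \<and> card S = CARD('m) + CARD('n) + 1 - k \<and> independent S)"
    if pos: "\<And>j. 0 < a $ j" "\<And>i. 0 < q $ i" and k: "1 \<le> k" "k \<le> CARD('m) + CARD('n)"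
    for \<Theta> :: "real ^ 'm ^ 'n" and a q k
  proof -
    \<comment> \<open>\<open>T\<close> scales the box to the unit cube. \<open>T'\<close> scales the
      transposed system inversely, with a sign, so that the factors \<open>a\<close> and
      \<open>q\<close> cancel and \<open>T z \<bullet> T' z'\<close> is the integral
      pairing.\<close>
    define T :: "(real ^ 'm) \<times> (real ^ 'n) \<Rightarrow> (real ^ 'm) \<times> (real ^ 'n)"
      where "T z = ((\<chi> j. fst z $ j / a $ j), (\<chi> i. (\<Theta> *v fst z - snd z) $ i / q $ i))" for z
    define T' :: "(real ^ 'n) \<times> (real ^ 'm) \<Rightarrow> (real ^ 'm) \<times> (real ^ 'n)"
      where "T' z = ((\<chi> j. a $ j * (transpose \<Theta> *v fst z - snd z) $ j), (\<chi> i. - (q $ i * fst z $ i)))" for z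
    have linT: "linear T"
      by (rule linearI) (simp_all add: T_def vec_eq_iff matrix_vector_right_distrib
          matrix_vector_mult_scaleR add_divide_distrib diff_divide_distrib right_diff_distrib)
    have linT': "linear T'"
      unfolding linear_iff T'_def
      by (simp add: vec_eq_iff matrix_vector_right_distrib
          matrix_vector_mult_scaleR algebra_simps del: transpose_matrix_vector)
    have pairing: "T z \<bullet> T' z' = snd z \<bullet> fst z' - fst z \<bullet> snd z'" for z z'
    proof -
      have "T z \<bullet> T' z' = fst z \<bullet> (transpose \<Theta> *v fst z' - snd z') - (\<Theta> *v fst z - snd z) \<bullet> fst z'"
        unfolding T_def T'_def inner_Pair inner_vec_def using pos[THEN less_imp_neq]
        by (simp add: sum_negf del: transpose_matrix_vector)
      then show ?thesis by (simp only: pairing_eq)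
    qed
    define \<Gamma> where "\<Gamma> = (int_vectors \<times> int_vectors :: ((real ^ 'm) \<times> (real ^ 'n)) set)"
    define L where "L = T ` \<Gamma>"
    have axes: "(axis j 1, 0) \<in> \<Gamma>" "(0, axis i 1) \<in> \<Gamma>" for i j
      by (auto simp: \<Gamma>_def int_vectors_def axis_def)
    have surjT': "\<exists>z'. T' z' = w" for w
    proof -
      define y where "y = (\<chi> i. - (snd w $ i / q $ i))"
      have "T' (y, transpose \<Theta> *v y - (\<chi> j. fst w $ j / a $ j)) = w"
        using pos[THEN less_imp_neq] by (simp add: T'_def y_def prod_eq_iff vec_eq_iff)
      then show ?thesis by blast
    qed
    have "discrete_subgroup L"
    proof -
      have "0 \<in> \<Gamma>" "\<And>x y. x \<in> \<Gamma> \<Longrightarrow> y \<in> \<Gamma> \<Longrightarrow> x - y \<in> \<Gamma>"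
        by (auto simp: \<Gamma>_def int_vectors_def zero_prod_def)
      then have "0 \<in> L" "\<forall>x\<in>L. \<forall>y\<in>L. x - y \<in> L"
        unfolding L_def
        by (metis image_iff linear_0[OF linT], metis (no_types, lifting) imageE imageI linear_diff[OF linT])
      moreover define e where "e = Min (range (\<lambda>j. 1 / a $ j) \<union> range (\<lambda>i. 1 / q $ i))"
      have "e > 0" using pos by (auto simp: e_def)
      moreover have ea: "e \<le> 1 / a $ j" and eq: "e \<le> 1 / q $ i" for i j
        unfolding e_def by (auto intro: Min_le)
      \<comment> \<open>If \<open>fst z = 0\<close>, the linear form reduces to
        \<open>- snd z\<close>; so in either case a nonzero integral coordinate survives, divided by
        one side of the box.\<close>
      have "e \<le> norm v" if "v \<in> L" "v \<noteq> 0" for v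
      proof -
        obtain z where z: "z \<in> \<Gamma>" "v = T z" using \<open>v \<in> L\<close> L_def by blast
        show ?thesis
        proof (cases "fst z = 0")
          case True
          have "snd z \<noteq> 0" using True that z linear_0[OF linT] by (metis prod.collapse zero_prod_def)
          then obtain i where "snd z $ i \<noteq> 0" by (auto simp: vec_eq_iff)
          moreover have "snd z $ i \<in> \<int>" using z by (auto simp: \<Gamma>_def int_vectors_def)
          ultimately have "1 \<le> \<bar>snd z $ i\<bar>" using Ints_nonzero_abs_ge1 by blast
          then have "1 / q $ i \<le> \<bar>snd v $ i\<bar>"
            using pos(2)[of i] z(2) True by (simp add: T_def divide_right_mono)
          also have "\<dots> \<le> norm v"
            by (metis component_le_norm_cart norm_snd_le order_trans prod.collapse)
          finally show ?thesis using eq[of i] by linarith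
        next
          case False
          then obtain j where "fst z $ j \<noteq> 0" by (auto simp: vec_eq_iff)
          moreover have "fst z $ j \<in> \<int>" using z by (auto simp: \<Gamma>_def int_vectors_def)
          ultimately have "1 \<le> \<bar>fst z $ j\<bar>" using Ints_nonzero_abs_ge1 by blast
          then have "1 / a $ j \<le> \<bar>fst v $ j\<bar>"
            using pos(1)[of j] z(2) by (simp add: T_def divide_right_mono)
          also have "\<dots> \<le> norm v"
            by (metis component_le_norm_cart norm_fst_le order_trans prod.collapse)
          finally show ?thesis using ea[of j] by linarith
        qed
      qed
      ultimately show ?thesis unfolding discrete_subgroup_def by blast
    qed
    moreover have "dim L \<le> CARD('m) + CARD('n)" using dim_subset_UNIV[of L] by simp
    ultimately have "has_reduced_basis L (CARD('m) + CARD('n)) C" by (rule C(2))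
    then obtain r b c where "r \<le> CARD('m) + CARD('n)" and b: "\<And>i. i < r \<Longrightarrow> b i \<in> L"
      and "\<And>i. i < r \<Longrightarrow> c i \<in> span L"
      and bc: "\<And>i. i < r \<Longrightarrow> norm (b i) * norm (c i) \<le> C"
      and bi: "\<And>i j. i < r \<Longrightarrow> j < r \<Longrightarrow> b i \<bullet> c j = (if i = j then 1 else 0)"
      and int: "\<And>v i. v \<in> L \<Longrightarrow> i < r \<Longrightarrow> v \<bullet> c i \<in> \<int>"
      and expand: "\<And>v. v \<in> L \<Longrightarrow> v = (\<Sum>i<r. (v \<bullet> c i) *\<^sub>R b i)"
      by (rule has_reduced_basisE) blast
    \<comment> \<open>Full rank: \<open>T\<close> is injective and maps the standard basis into
      \<open>L\<close>, so \<open>L\<close> contains d independent vectors.\<close>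
    have r: "CARD('m) + CARD('n) \<le> r"
    proof -
      have "Basis \<subseteq> \<Gamma>" using axes by (auto simp: Basis_prod_def Basis_vec_def)
      moreover have "inj T"
      proof (rule injI)
        fix x y assume "T x = T y"
        then have 1: "fst x = fst y" using pos[THEN less_imp_neq] by (simp add: T_def vec_eq_iff)
        then have "snd x = snd y"
          using \<open>T x = T y\<close> pos[THEN less_imp_neq] unfolding T_def by (simp add: vec_eq_iff[of "snd x"] vec_eq_iff[where x = "vec_lambda _"])
        with 1 show "x = y" by (simp add: prod_eq_iff)
      qed
      then have "dim (T ` Basis) = dim (Basis :: ((real ^ 'm) \<times> (real ^ 'n)) set)"
        by (intro dim_image_eq[OF linT]) (auto intro: inj_on_subset)
      then have "dim (T ` Basis) = CARD('m) + CARD('n)"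
        by (metis DIM_cart DIM_prod DIM_real dim_UNIV dim_span mult.right_neutral span_Basis)
      ultimately have "dim (T ` Basis) = CARD('m) + CARD('n)" "T ` Basis \<subseteq> L"
        unfolding L_def by auto
      moreover have "L \<subseteq> span (b ` {..<r})"
      proof
        fix v assume "v \<in> L"
        from expand[OF this] show "v \<in> span (b ` {..<r})"
          by (metis (no_types, lifting) imageI span_base span_scale span_sum)
      qed
      then have "dim L \<le> card (b ` {..<r})" by (rule dim_le_card) simp
      moreover have "card (b ` {..<r}) \<le> r" using card_image_le[of "{..<r}" b] by simp
      ultimately show ?thesis using dim_subset[of "T ` Basis" L] by linarith
    qed
    have "\<exists>z. z \<in> \<Gamma> \<and> T z = b i" if "i < r" for i using b[OF that] unfolding L_def by (metis imageE)
    then obtain z where z\<Gamma>: "\<And>i. i < r \<Longrightarrow> z i \<in> \<Gamma>" and Tz: "\<And>i. i < r \<Longrightarrow> T (z i) = b i" by metis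
    have "\<forall>i. \<exists>w. T' w = c i" using surjT' by blast
    from choice[OF this] obtain z' where T'z': "\<And>i. T' (z' i) = c i" by blast
    \<comment> \<open>\<open>c i\<close> pairs integrally with all of \<open>L\<close>; testing it
      against the images of the unit vectors reads off the coordinates of \<open>z' i\<close> up to
      sign.\<close>
    have z'_int: "fst (z' i) \<in> int_vectors" "snd (z' i) \<in> int_vectors" if "i < r" for i
    proof -
      have *: "snd p \<bullet> fst (z' i) - fst p \<bullet> snd (z' i) \<in> \<int>" if "p \<in> \<Gamma>" for p
        using int[of "T p" i] \<open>i < r\<close> that pairing[of p "z' i"] T'z' by (simp add: L_def)
      have "- (snd (z' i) $ j) \<in> \<int>" for j
        using *[OF axes(1), of j] by (simp add: inner_axis inner_axis')
      then show "snd (z' i) \<in> int_vectors" by (simp add: int_vectors_def)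
      show "fst (z' i) \<in> int_vectors"
        using *[OF axes(2)] by (simp add: inner_axis inner_axis' int_vectors_def)
    qed
    define I where "I = {i. i < r \<and> norm (b i) \<le> 1}"
    define J where "J = {i. i < r \<and> 1 < norm (b i)}"
    have fin: "finite I" "finite J" by (auto simp: I_def J_def)
    have "I \<union> J = {..<r}" "I \<inter> J = {}" by (auto simp: I_def J_def)
    then have cardIJ: "card I + card J = r" using fin by (metis card_Un_disjoint card_lessThan)
    have z_box: "z i \<in> box_solutions a q \<Theta>" if "i \<in> I" for i
    proof -
      have i: "i < r" "norm (T (z i)) \<le> 1" using that Tz by (auto simp: I_def)
      have h: "\<bar>fst (T (z i)) $ j\<bar> \<le> 1" "\<bar>snd (T (z i)) $ l\<bar> \<le> 1" for j l
        using i(2) by (metis component_le_norm_cart norm_fst_le norm_snd_le order_trans prod.collapse)+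
      have "\<bar>fst (z i) $ j\<bar> \<le> a $ j" "\<bar>(\<Theta> *v fst (z i) - snd (z i)) $ l\<bar> \<le> q $ l" for j l
        using pos(1)[of j] pos(2)[of l] h(1)[of j] h(2)[of l] by (auto simp: T_def pos_divide_le_eq)
      then show ?thesis using z\<Gamma>[OF i(1)] by (auto simp: box_solutions_def \<Gamma>_def)
    qed
    have z'_box: "z' i \<in> box_solutions (\<chi> i. (C + 1) / q $ i) (\<chi> j. (C + 1) / a $ j) (transpose \<Theta>)"
      if "i \<in> J" for i
    proof -
      have i: "i < r" "1 < norm (b i)" using that by (auto simp: J_def)
      have "1 * norm (c i) \<le> norm (b i) * norm (c i)" using i by (intro mult_right_mono) auto
      then have "norm (T' (z' i)) \<le> C + 1" using bc[OF i(1)] T'z' by simp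
      then have h: "\<bar>fst (T' (z' i)) $ j\<bar> \<le> C + 1" "\<bar>snd (T' (z' i)) $ l\<bar> \<le> C + 1" for j l
        by (metis component_le_norm_cart norm_fst_le norm_snd_le order_trans prod.collapse)+
      have "\<bar>(transpose \<Theta> *v fst (z' i) - snd (z' i)) $ j\<bar> \<le> (C + 1) / a $ j"
        "\<bar>fst (z' i) $ l\<bar> \<le> (C + 1) / q $ l" for j l
        using pos(1)[of j] pos(2)[of l] h(1)[of j] h(2)[of l]
        by (auto simp: T'_def abs_mult pos_le_divide_eq mult.commute simp del: transpose_matrix_vector)
      then show ?thesis using z'_int[OF i(1)]
        by (simp add: box_solutions_def case_prod_beta del: transpose_matrix_vector)
    qed
    show ?thesis
    proof (cases "k \<le> card I")
      case True
      then obtain K where K: "K \<subseteq> I" "card K = k" "finite K" by (rule obtain_subset_with_card_n)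
      have "linear (\<lambda>p. T p \<bullet> c j)" for j
        using linT by (simp add: linear_iff inner_add_left)
      moreover have "T (z i) \<bullet> c j = (if i = j then 1 else 0)" if "i \<in> K" "j \<in> K" for i j
      proof -
        have "i < r" "j < r" using K that by (auto simp: I_def)
        then show ?thesis using Tz bi by simp
      qed
      ultimately have "inj_on z K" "independent (z ` K)"
        using independent_if_dual_functionals[OF K(3), of "\<lambda>j p. T p \<bullet> c j" z] by auto
      then show ?thesis using K z_box by (intro disjI1 exI[of _ "z ` K"]) (auto simp: card_image)
    next
      case False
      then have "CARD('m) + CARD('n) + 1 - k \<le> card J" using cardIJ r by linarith
      then obtain K where K: "K \<subseteq> J" "card K = CARD('m) + CARD('n) + 1 - k" "finite K"
        by (rule obtain_subset_with_card_n)
      have "linear (\<lambda>p. b j \<bullet> T' p)" for j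
        using linT' by (simp add: linear_iff inner_add_right)
      moreover have "b j \<bullet> T' (z' i) = (if i = j then 1 else 0)" if "i \<in> K" "j \<in> K" for i j
      proof -
        have "i < r" "j < r" using K that by (auto simp: J_def)
        then show ?thesis using T'z' bi by simp
      qed
      ultimately have "inj_on z' K" "independent (z' ` K)"
        using independent_if_dual_functionals[OF K(3), of "\<lambda>j p. b j \<bullet> T' p" z'] by auto
      then show ?thesis using K z'_box by (intro disjI2 exI[of _ "z' ` K"]) (auto simp: card_image)
    qed
  qed
  note main = this
  show ?thesis
  proof (intro exI[of _ "C + 1"] conjI allI impI)
    show "0 < C + 1" using C(1) by simp
  qed (rule main; simp)
qed

section \<open>Weighted norms as boxes, and powers of t near infinity\<close>

text \<open>The case \<open>u = 0\<close>, which occurs for vanishing coordinates, is covered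
  because \<open>0 powr p\<close> is 0 for every \<open>p\<close>.\<close>

lemma powr_inverse_le_iff:
  fixes u t w :: real
  assumes "0 \<le> u" "0 < t" "0 < w"
  shows "u powr (1 / w) \<le> t \<longleftrightarrow> u \<le> t powr w"
proof
  assume "u powr (1 / w) \<le> t"
  then have "(u powr (1 / w)) powr w \<le> t powr w" using assms by (intro powr_mono2) auto
  then show "u \<le> t powr w" using assms by (simp add: powr_powr)
next
  assume "u \<le> t powr w"
  then have "u powr (1 / w) \<le> (t powr w) powr (1 / w)" using assms by (intro powr_mono2) auto
  then show "u powr (1 / w) \<le> t" using assms by (simp add: powr_powr)
qed

lemma weighted_norm_le_iff:
  fixes w x :: "real ^ 'n"
  assumes "\<And>i. 0 < w $ i" "0 < t"
  shows "weighted_norm w x \<le> t \<longleftrightarrow> (\<forall>i. \<bar>x $ i\<bar> \<le> t powr (w $ i))"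
proof -
  have "weighted_norm w x \<le> t \<longleftrightarrow> (\<forall>i. \<bar>x $ i\<bar> powr (1 / w $ i) \<le> t)"
    by (simp add: weighted_norm_def)
  then show ?thesis using powr_inverse_le_iff[OF abs_ge_zero assms(2) assms(1)] by simp
qed

lemma approx_solutions_eq_box:
  assumes "\<And>j. 0 < \<sigma> $ j" "\<And>i. 0 < \<rho> $ i" "0 < t"
  shows "approx_solutions \<sigma> \<rho> \<Theta> \<gamma> t =
    box_solutions (\<chi> j. t powr (\<sigma> $ j)) (\<chi> i. t powr (- (\<gamma> * \<rho> $ i))) \<Theta>"
  using assms unfolding approx_solutions_def box_solutions_def
  by (simp add: weighted_norm_le_iff powr_powr)

lemma box_solutions_mono:
  assumes "\<And>j. a $ j \<le> a' $ j" "\<And>i. q $ i \<le> q' $ i"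
  shows "box_solutions a q \<Theta> \<subseteq> box_solutions a' q' \<Theta>"
  unfolding box_solutions_def
  by (auto intro: order_trans[OF _ assms(1)] order_trans[OF _ assms(2)])

text \<open>This absorbs the transference constant at the price of an arbitrarily small change of
  the exponent.\<close>

lemma eventually_le_powr:
  fixes C p :: real
  assumes "0 < p"
  shows "\<forall>\<^sub>F t in at_top. C \<le> t powr p"
  using eventually_ge_at_top[of "(\<bar>C\<bar> + 1) powr (1 / p)"]
proof eventually_elim
  case (elim t)
  then have "((\<bar>C\<bar> + 1) powr (1 / p)) powr p \<le> t powr p" using assms by (intro powr_mono2) auto
  then show ?case using assms by (simp add: powr_powr)
qed

text \<open>The parameter of the transposed system is a power of t. This substitution has to respect
  both solvability for all large t and solvability for arbitrarily large t.\<close>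

lemma filtermap_powr_at_top:
  fixes p :: real
  assumes "0 < p"
  shows "filtermap (\<lambda>t. t powr p) at_top = at_top"
proof (rule filtermap_fun_inverse[of "\<lambda>s. s powr (1 / p)"])
  show "filterlim (\<lambda>s::real. s powr (1 / p)) at_top at_top" "filterlim (\<lambda>s::real. s powr p) at_top at_top"
    unfolding filterlim_at_top using assms by (simp_all add: eventually_le_powr)
  show "\<forall>\<^sub>F x::real in at_top. (x powr (1 / p)) powr p = x"
    using eventually_gt_at_top[of 0] by eventually_elim (use assms in \<open>simp add: powr_powr\<close>)
qed

lemma eventually_powr_at_top_iff:
  fixes p :: real
  assumes "0 < p"
  shows "(\<forall>\<^sub>F t in at_top. P (t powr p)) \<longleftrightarrow> (\<forall>\<^sub>F t in at_top. P t)"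
  by (metis (no_types) assms eventually_filtermap filtermap_powr_at_top)

lemma frequently_powr_at_top_iff:
  fixes p :: real
  assumes "0 < p"
  shows "(\<exists>\<^sub>F t in at_top. P (t powr p)) \<longleftrightarrow> (\<exists>\<^sub>F t in at_top. P t)"
  unfolding frequently_def using eventually_powr_at_top_iff[OF assms, of "\<lambda>t. \<not> P t"] by simp

section \<open>The alternative between a system and its transpose for large t\<close>

text \<open>At the parameter \<open>t powr \<gamma>'\<close>, the transposed system has sides larger
  than \<open>1 / q $ i\<close> and \<open>1 / a $ j\<close> by the factors
  \<open>t powr ((\<gamma>' - \<gamma>) * \<rho> $ i)\<close> and
  \<open>t powr ((1 - \<gamma>' * \<delta>) * \<sigma> $ j)\<close>. Both exponents are positive, so
  these factors eventually exceed the constant of the transference.\<close>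

lemma eventually_solutions_or_dual_solutions:
  fixes \<Theta> :: "real ^ 'm ^ 'n"
  assumes w: "\<And>j. 0 < \<sigma> $ j" "\<And>i. 0 < \<rho> $ i" and k: "1 \<le> k" "k \<le> CARD('m) + CARD('n)"
    and \<gamma>: "\<gamma> < \<gamma>'" "\<gamma>' * \<delta> < 1"
  shows "\<forall>\<^sub>F t in at_top. has_independent_solutions k \<sigma> \<rho> \<Theta> \<gamma> t \<or>
    has_independent_solutions (CARD('m) + CARD('n) + 1 - k) \<rho> \<sigma> (transpose \<Theta>) \<delta> (t powr \<gamma>')"
proof -
  obtain C where "0 < C" and C: "\<forall>(\<Theta> :: real ^ 'm ^ 'n) a q k.
     (\<forall>j. 0 < a $ j) \<longrightarrow> (\<forall>i. 0 < q $ i) \<longrightarrow> 1 \<le> k \<longrightarrow> k \<le> CARD('m) + CARD('n) \<longrightarrow>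
     (\<exists>S \<subseteq> box_solutions a q \<Theta>. finite S \<and> card S = k \<and> independent S) \<or>
     (\<exists>S \<subseteq> box_solutions (\<chi> i. C / q $ i) (\<chi> j. C / a $ j) (transpose \<Theta>).
        finite S \<and> card S = CARD('m) + CARD('n) + 1 - k \<and> independent S)"
    using ex_transference_const[where ?'m = 'm and ?'n = 'n] by (elim exE conjE)
  have "\<forall>\<^sub>F t in at_top. \<forall>i. C \<le> t powr ((\<gamma>' - \<gamma>) * \<rho> $ i)"
    using w \<gamma> by (intro eventually_all_finite eventually_le_powr) simp
  moreover have "\<forall>\<^sub>F t in at_top. \<forall>j. C \<le> t powr ((1 - \<gamma>' * \<delta>) * \<sigma> $ j)"
    using w \<gamma> by (intro eventually_all_finite eventually_le_powr) simp
  ultimately show ?thesis using eventually_gt_at_top[of 0]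
  proof eventually_elim
    case (elim t)
    define a where "a = (\<chi> j. t powr (\<sigma> $ j))"
    define q where "q = (\<chi> i. t powr (- (\<gamma> * \<rho> $ i)))"
    define B where "B = box_solutions (\<chi> i. (t powr \<gamma>') powr (\<rho> $ i))
      (\<chi> j. (t powr \<gamma>') powr (- (\<delta> * \<sigma> $ j))) (transpose \<Theta>)"
    have eq: "approx_solutions \<sigma> \<rho> \<Theta> \<gamma> t = box_solutions a q \<Theta>"
      unfolding a_def q_def by (rule approx_solutions_eq_box[OF w elim(3)])
    have eq': "approx_solutions \<rho> \<sigma> (transpose \<Theta>) \<delta> (t powr \<gamma>') = B"
      unfolding B_def by (rule approx_solutions_eq_box[OF w(2,1)]) (use elim(3) in simp)
    have "C / q $ i \<le> (t powr \<gamma>') powr (\<rho> $ i)" for i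
    proof -
      have "C / q $ i = C * t powr (\<gamma> * \<rho> $ i)" by (simp add: q_def powr_minus field_simps)
      also have "\<dots> \<le> t powr ((\<gamma>' - \<gamma>) * \<rho> $ i) * t powr (\<gamma> * \<rho> $ i)"
        using elim(1) by (intro mult_right_mono) auto
      also have "\<dots> = (t powr \<gamma>') powr (\<rho> $ i)"
        by (simp add: powr_powr algebra_simps flip: powr_add)
      finally show ?thesis .
    qed
    moreover have "C / a $ j \<le> (t powr \<gamma>') powr (- (\<delta> * \<sigma> $ j))" for j
    proof -
      have "C / a $ j = C * t powr (- (\<sigma> $ j))" by (simp add: a_def powr_minus field_simps)
      also have "\<dots> \<le> t powr ((1 - \<gamma>' * \<delta>) * \<sigma> $ j) * t powr (- (\<sigma> $ j))"
        using elim(2) by (intro mult_right_mono) auto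
      also have "\<dots> = (t powr \<gamma>') powr (- (\<delta> * \<sigma> $ j))"
        by (simp add: powr_powr algebra_simps flip: powr_add)
      finally show ?thesis .
    qed
    ultimately have "box_solutions (\<chi> i. C / q $ i) (\<chi> j. C / a $ j) (transpose \<Theta>) \<subseteq> B"
      unfolding B_def by (intro box_solutions_mono) auto
    moreover have "\<forall>j. 0 < a $ j" "\<forall>i. 0 < q $ i" using elim(3) by (auto simp: a_def q_def)
    note C[rule_format, of a q k \<Theta>, OF this[rule_format] k]
    ultimately show ?case
      unfolding has_independent_solutions_def eq eq' by (meson order_trans)
  qed
qed

text \<open>With both inequalities reversed, every term of the bound on the pairing is a negative
  power of t. Their sum falls below 1, which \<open>box_solutions_dual_obstruction\<close> forbids
  for d + 1 independent points in total.\<close>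

lemma eventually_not_solutions_and_dual_solutions:
  fixes \<Theta> :: "real ^ 'm ^ 'n"
  assumes w: "\<And>j. 0 < \<sigma> $ j" "\<And>i. 0 < \<rho> $ i" and k: "k \<le> CARD('m) + CARD('n)"
    and \<gamma>: "\<gamma>' < \<gamma>" "1 < \<gamma>' * \<delta>"
  shows "\<forall>\<^sub>F t in at_top. \<not> (has_independent_solutions k \<sigma> \<rho> \<Theta> \<gamma> t \<and>
    has_independent_solutions (CARD('m) + CARD('n) + 1 - k) \<rho> \<sigma> (transpose \<Theta>) \<delta> (t powr \<gamma>'))"
proof -
  have "((\<lambda>t. (\<Sum>j\<in>UNIV. t powr ((1 - \<gamma>' * \<delta>) * \<sigma> $ j)) + (\<Sum>i\<in>UNIV. t powr ((\<gamma>' - \<gamma>) * \<rho> $ i))) \<longlongrightarrow>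
    (\<Sum>j\<in>(UNIV::'m set). 0) + (\<Sum>i\<in>(UNIV::'n set). 0::real)) at_top"
    using w \<gamma> by (intro tendsto_add tendsto_sum tendsto_neg_powr filterlim_ident) (simp_all add: mult_neg_pos)
  then have "\<forall>\<^sub>F t in at_top. (\<Sum>j\<in>UNIV. t powr ((1 - \<gamma>' * \<delta>) * \<sigma> $ j)) +
      (\<Sum>i\<in>UNIV. t powr ((\<gamma>' - \<gamma>) * \<rho> $ i)) < 1"
    by (rule order_tendstoD) simp
  then show ?thesis using eventually_gt_at_top[of 0]
  proof eventually_elim
    case (elim t)
    define a where "a = (\<chi> j. t powr (\<sigma> $ j))"
    define q where "q = (\<chi> i. t powr (- (\<gamma> * \<rho> $ i)))"
    define a' where "a' = (\<chi> i. (t powr \<gamma>') powr (\<rho> $ i))"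
    define q' where "q' = (\<chi> j. (t powr \<gamma>') powr (- (\<delta> * \<sigma> $ j)))"
    have eq: "approx_solutions \<sigma> \<rho> \<Theta> \<gamma> t = box_solutions a q \<Theta>"
      unfolding a_def q_def by (rule approx_solutions_eq_box[OF w elim(2)])
    have eq': "approx_solutions \<rho> \<sigma> (transpose \<Theta>) \<delta> (t powr \<gamma>') = box_solutions a' q' (transpose \<Theta>)"
      unfolding a'_def q'_def by (rule approx_solutions_eq_box[OF w(2,1)]) (use elim(2) in simp)
    have "(\<Sum>j\<in>UNIV. a $ j * q' $ j) + (\<Sum>i\<in>UNIV. q $ i * a' $ i) =
      (\<Sum>j\<in>UNIV. t powr ((1 - \<gamma>' * \<delta>) * \<sigma> $ j)) + (\<Sum>i\<in>UNIV. t powr ((\<gamma>' - \<gamma>) * \<rho> $ i))"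
      unfolding a_def q_def a'_def q'_def by (simp add: powr_powr algebra_simps flip: powr_add)
    then have small: "(\<Sum>j\<in>UNIV. a $ j * q' $ j) + (\<Sum>i\<in>UNIV. q $ i * a' $ i) < 1" using elim(1) by simp
    show ?case
    proof
      assume "has_independent_solutions k \<sigma> \<rho> \<Theta> \<gamma> t \<and>
        has_independent_solutions (CARD('m) + CARD('n) + 1 - k) \<rho> \<sigma> (transpose \<Theta>) \<delta> (t powr \<gamma>')"
      then obtain S S' where
        S: "S \<subseteq> box_solutions a q \<Theta>" "finite S" "independent S" "card S = k" and
        S': "S' \<subseteq> box_solutions a' q' (transpose \<Theta>)" "finite S'" "independent S'"
          "card S' = CARD('m) + CARD('n) + 1 - k"
        unfolding has_independent_solutions_def eq eq' by blast
      have "CARD('m) + CARD('n) < card S + card S'" using k S(4) S'(4) by simp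
      from box_solutions_dual_obstruction[OF S(1-3) S'(1-3) this] small show False by linarith
    qed
  qed
qed

text \<open>The bound on the linear forms tends to infinity, so standard basis vectors are
  solutions. This makes all four suprema nonnegative.\<close>

lemma eventually_solutions_negative_exponent:
  fixes \<Theta> :: "real ^ 'm ^ 'n"
  assumes w: "\<And>j. 0 < \<sigma> $ j" "\<And>i. 0 < \<rho> $ i" and k: "k \<le> CARD('m) + CARD('n)" and "\<gamma> < 0"
  shows "\<forall>\<^sub>F t in at_top. has_independent_solutions k \<sigma> \<rho> \<Theta> \<gamma> t"
proof -
  have "k \<le> card (Basis :: ((real ^ 'm) \<times> (real ^ 'n)) set)" using k by simp
  then obtain S :: "((real ^ 'm) \<times> (real ^ 'n)) set" where S: "S \<subseteq> Basis" "card S = k" "finite S"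
    by (rule obtain_subset_with_card_n)
  have ind: "independent S" using S(1) independent_Basis independent_mono by blast
  have "\<forall>\<^sub>F t in at_top. \<forall>z\<in>S. \<forall>i. \<bar>(\<Theta> *v fst z - snd z) $ i\<bar> \<le> t powr (- (\<gamma> * \<rho> $ i))"
    using w \<open>\<gamma> < 0\<close> by (intro eventually_ball_finite S eventually_all_finite ballI eventually_le_powr)
      (simp add: mult_neg_pos)
  then show ?thesis using eventually_ge_at_top[of 1]
  proof eventually_elim
    case (elim t)
    have "z \<in> box_solutions (\<chi> j. t powr (\<sigma> $ j)) (\<chi> i. t powr (- (\<gamma> * \<rho> $ i))) \<Theta>" if "z \<in> S" for z
    proof -
      have "z \<in> Basis" using that S by blast
      then have 01: "fst z $ j \<in> {0, 1}" "snd z $ i \<in> {0, 1}" for i j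
        by (auto simp: Basis_prod_def Basis_vec_def axis_def)
      then have "fst z $ j \<in> \<int>" "snd z $ i \<in> \<int>" for i j
        by (metis Ints_0 Ints_1 empty_iff insert_iff)+
      then have "fst z \<in> int_vectors" "snd z \<in> int_vectors" by (simp_all add: int_vectors_def)
      moreover have "\<bar>fst z $ j\<bar> \<le> t powr (\<sigma> $ j)" for j
      proof -
        have "\<bar>fst z $ j\<bar> \<le> 1" using 01(1)[of j] by auto
        also have "1 \<le> t powr (\<sigma> $ j)" using elim(2) w(1)[of j] by (simp add: ge_one_powr_ge_zero)
        finally show ?thesis .
      qed
      moreover have "\<bar>(\<Theta> *v fst z - snd z) $ i\<bar> \<le> t powr (- (\<gamma> * \<rho> $ i))" for i
        using elim(1) that by blast
      ultimately show ?thesis by (simp add: box_solutions_def case_prod_beta)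
    qed
    then have "S \<subseteq> approx_solutions \<sigma> \<rho> \<Theta> \<gamma> t"
      using approx_solutions_eq_box[OF w, of t \<Theta> \<gamma>] elim(2) by auto
    then show ?case using S ind unfolding has_independent_solutions_def by blast
  qed
qed

section \<open>Reciprocity of the exponents\<close>

text \<open>Let a and b be the two suprema. The assumption \<open>le\<close> bounds b above by 1/x
  for positive x below a, and \<open>or\<close> bounds it below by 1/x for positive x above a, so b
  is squeezed to 1/a. Negative numbers in both sets make a and b nonnegative, which leaves 0 and
  infinity as the degenerate values.\<close>

lemma product_one_Sup:
  fixes A B :: "real set"
  assumes neg: "\<And>x. x < 0 \<Longrightarrow> x \<in> A" "\<And>x. x < 0 \<Longrightarrow> x \<in> B"
    and le: "\<And>x y. x \<in> A \<Longrightarrow> y \<in> B \<Longrightarrow> 0 < x \<Longrightarrow> 0 < y \<Longrightarrow> x * y \<le> 1"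
    and or: "\<And>x y. 0 < x \<Longrightarrow> 0 < y \<Longrightarrow> x * y < 1 \<Longrightarrow> x \<in> A \<or> y \<in> B"
  shows "product_one (Sup (ereal ` A)) (Sup (ereal ` B))"
proof -
  have nonneg: "0 \<le> Sup (ereal ` X)" if "\<And>x. x < 0 \<Longrightarrow> x \<in> X" for X
  proof (rule dense_le)
    fix y :: ereal assume "y < 0"
    with that show "y \<le> Sup (ereal ` X)" by (cases y) (auto intro: Sup_upper)
  qed
  define a where "a = Sup (ereal ` A)"
  define b where "b = Sup (ereal ` B)"
  have a0: "0 \<le> a" and b0: "0 \<le> b" using nonneg neg unfolding a_def b_def by blast+
  \<comment> \<open>Some member \<open>u\<close> of \<open>A\<close> exceeds \<open>x\<close>, and
    then \<open>x * y \<le> u * y \<le> 1\<close> for every positive \<open>y\<close> in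
    \<open>B\<close>.\<close>
  have upper: "b \<le> ereal (1 / x)" if x: "0 < x" "ereal x < a" for x
  proof -
    obtain u where u: "u \<in> A" "x < u" using x unfolding a_def less_Sup_iff by auto
    have "y \<le> 1 / x" if "y \<in> B" for y
    proof (cases "0 < y")
      case True
      have "x * y \<le> u * y" using u True by simp
      also have "\<dots> \<le> 1" using le u that True x by simp
      finally show ?thesis using x by (simp add: field_simps)
    next
      case False
      then have "y \<le> 0" by simp
      also have "0 \<le> 1 / x" using x by simp
      finally show ?thesis .
    qed
    then show ?thesis unfolding b_def by (auto intro: Sup_least)
  qed
  \<comment> \<open>Since \<open>x\<close> lies outside \<open>A\<close>, every positive number
    below \<open>1 / x\<close> is forced into \<open>B\<close>.\<close>
  have lower: "ereal (1 / x) \<le> b" if x: "0 < x" "a < ereal x" for x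
  proof (rule dense_le)
    fix y assume y: "y < ereal (1 / x)"
    have "x \<notin> A" using x Sup_upper[of "ereal x" "ereal ` A"] unfolding a_def by fastforce
    show "y \<le> b"
    proof (cases "0 < y")
      case True
      then obtain s where s: "y = ereal s" "0 < s" using y by (cases y) auto
      then have "x * s < 1" using y x by (simp add: field_simps)
      then have "s \<in> B" using or x s \<open>x \<notin> A\<close> by blast
      then show ?thesis unfolding b_def s by (auto intro: Sup_upper)
    next
      case False
      then show ?thesis using b0 by (meson not_less order_trans)
    qed
  qed
  consider "a = \<infinity>" | "a = 0" | r where "a = ereal r" "0 < r"
    using a0 by (cases a) (auto simp: zero_ereal_def less_le)
  then have "product_one a b"
  proof cases
    case 1
    have "b \<le> 0"
    proof (rule dense_ge)
      fix y :: ereal assume "0 < y"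
      then show "b \<le> y" using upper[of "1 / real_of_ereal y"] 1 by (cases y) auto
    qed
    then show ?thesis using 1 b0 by (simp add: product_one_def)
  next
    case 2
    have "ereal s \<le> b" for s
    proof (cases "0 < s")
      case True
      then show ?thesis using lower[of "1 / s"] 2 by simp
    next
      case False
      then have "ereal s \<le> 0" by simp
      then show ?thesis using b0 by (rule order_trans)
    qed
    then have "b = \<infinity>" by (rule ereal_top)
    then show ?thesis using 2 by (simp add: product_one_def)
  next
    case 3
    have "b \<le> ereal (1 / r)"
    proof (rule dense_ge)
      fix y assume y: "ereal (1 / r) < y"
      show "b \<le> y"
      proof (cases y)
        case (real s)
        then have "0 < s" using y 3(2) by (simp add: order.strict_trans[of 0 "1 / r" s])
        moreover from this have "1 / s < r" using y 3(2) real by (simp add: field_simps)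
        ultimately show ?thesis using upper[of "1 / s"] 3 real by simp
      qed (use y in auto)
    qed
    moreover have "ereal (1 / r) \<le> b"
    proof (rule dense_le)
      fix y assume y: "y < ereal (1 / r)"
      show "y \<le> b"
      proof (cases "0 < y")
        case True
        then obtain s where s: "y = ereal s" "0 < s" using y by (cases y) auto
        then have "r < 1 / s" using y 3(2) by (simp add: field_simps)
        then show ?thesis using lower[of "1 / s"] 3 s by simp
      next
        case False
        then show ?thesis using b0 by (meson not_less order_trans)
      qed
    qed
    ultimately have "b = ereal (1 / r)" by simp
    then show ?thesis using 3 by (simp add: product_one_def one_ereal_def)
  qed
  then show ?thesis unfolding a_def b_def .
qed

theorem theorem5:
  fixes \<Theta> :: "real ^ 'm::{finite,linorder} ^ 'n::{finite,linorder}"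
    and \<sigma> :: "real ^ 'm::{finite,linorder}" and \<rho> :: "real ^ 'n::{finite,linorder}" and k :: nat
  assumes "\<And>i j. i \<le> j \<Longrightarrow> \<sigma> $ j \<le> \<sigma> $ i" and "\<And>j. \<sigma> $ j > 0"
    and "\<And>i j. i \<le> j \<Longrightarrow> \<rho> $ j \<le> \<rho> $ i" and "\<And>i. \<rho> $ i > 0"
    and "(\<Sum>j\<in>UNIV. \<sigma> $ j) = 1" and "(\<Sum>i\<in>UNIV. \<rho> $ i) = 1"
    and "1 \<le> k" and "k \<le> CARD('m) + CARD('n)"
  shows "product_one (omega_exp k \<sigma> \<rho> \<Theta>)
           (omega_hat_exp (CARD('m) + CARD('n) + 1 - k) \<rho> \<sigma> (transpose \<Theta>))
       \<and> product_one (omega_hat_exp k \<sigma> \<rho> \<Theta>)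
           (omega_exp (CARD('m) + CARD('n) + 1 - k) \<rho> \<sigma> (transpose \<Theta>))"
proof -
  define k' where "k' = CARD('m) + CARD('n) + 1 - k"
  define H where "H = has_independent_solutions k \<sigma> \<rho> \<Theta>"
  define H' where "H' = has_independent_solutions k' \<rho> \<sigma> (transpose \<Theta>)"
  have k': "k' \<le> CARD('n) + CARD('m)" using assms(7) by (simp add: k'_def)
  have neg: "\<forall>\<^sub>F t in at_top. H \<gamma> t" "\<forall>\<^sub>F t in at_top. H' \<gamma> t" if "\<gamma> < 0" for \<gamma>
    unfolding H_def H'_def using assms k' that by (auto intro: eventually_solutions_negative_exponent)
  have neg': "\<exists>\<^sub>F t in at_top. H \<gamma> t" "\<exists>\<^sub>F t in at_top. H' \<gamma> t" if "\<gamma> < 0" for \<gamma>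
    using neg[OF that] by (auto intro: eventually_frequently)
  \<comment> \<open>The gap between \<open>1 / \<delta>\<close> and \<open>\<gamma>\<close> supplies
    an exponent \<open>g\<close> with \<open>g < \<gamma>\<close> and
    \<open>1 < g * \<delta>\<close>.\<close>
  have not_both: "\<exists>g>0. \<forall>\<^sub>F t in at_top. \<not> (H \<gamma> t \<and> H' \<delta> (t powr g))"
    if "0 < \<gamma>" "0 < \<delta>" "1 < \<gamma> * \<delta>" for \<gamma> \<delta>
  proof -
    have "1 / \<delta> < \<gamma>" using that by (simp add: field_simps)
    then obtain g where g: "1 / \<delta> < g" "g < \<gamma>" using dense by blast
    have "0 < g" using g(1) that(2) by (meson divide_pos_pos less_trans zero_less_one)
    moreover have "1 < g * \<delta>" using g(1) that by (simp add: field_simps)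
    ultimately show ?thesis
      unfolding H_def H'_def k'_def using eventually_not_solutions_and_dual_solutions assms g(2) by blast
  qed
  \<comment> \<open>Now \<open>\<gamma>\<close> is the smaller end of the gap, and \<open>g\<close>
    satisfies the opposite inequalities.\<close>
  have one: "\<exists>g>0. \<forall>\<^sub>F t in at_top. H \<gamma> t \<or> H' \<delta> (t powr g)"
    if "0 < \<gamma>" "0 < \<delta>" "\<gamma> * \<delta> < 1" for \<gamma> \<delta>
  proof -
    have "\<gamma> < 1 / \<delta>" using that by (simp add: field_simps)
    then obtain g where g: "\<gamma> < g" "g < 1 / \<delta>" using dense by blast
    have "0 < g" using g(1) that(1) by linarith
    moreover have "g * \<delta> < 1" using g(2) that by (simp add: field_simps)
    ultimately show ?thesis
      unfolding H_def H'_def k'_def using eventually_solutions_or_dual_solutions assms g(1) by blast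
  qed
  \<comment> \<open>Negation exchanges frequent and eventual solvability, which is why an ordinary
    exponent is paired with a uniform one. \<open>not_both\<close> and \<open>one\<close> supply the
    two assumptions on products, after passing between t and \<open>t powr g\<close>.\<close>
  have "product_one (Sup (ereal ` {\<gamma>. \<exists>\<^sub>F t in at_top. H \<gamma> t})) (Sup (ereal ` {\<delta>. \<forall>\<^sub>F t in at_top. H' \<delta> t}))"
  proof (rule product_one_Sup)
    fix \<gamma> \<delta> :: real assume *: "\<gamma> \<in> {\<gamma>. \<exists>\<^sub>F t in at_top. H \<gamma> t}" "\<delta> \<in> {\<delta>. \<forall>\<^sub>F t in at_top. H' \<delta> t}" "0 < \<gamma>" "0 < \<delta>"
    show "\<gamma> * \<delta> \<le> 1"
    proof (rule ccontr)
      assume "\<not> \<gamma> * \<delta> \<le> 1"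
      then obtain g where g: "0 < g" "\<forall>\<^sub>F t in at_top. \<not> (H \<gamma> t \<and> H' \<delta> (t powr g))"
        using not_both * by (meson not_le)
      have "\<forall>\<^sub>F t in at_top. H' \<delta> (t powr g)" using * eventually_powr_at_top_iff[OF g(1)] by simp
      with g(2) have "\<forall>\<^sub>F t in at_top. \<not> H \<gamma> t" by eventually_elim blast
      then show False using * by (simp add: frequently_def)
    qed
  next
    fix \<gamma> \<delta> :: real assume *: "0 < \<gamma>" "0 < \<delta>" "\<gamma> * \<delta> < 1"
    then obtain g where g: "0 < g" "\<forall>\<^sub>F t in at_top. H \<gamma> t \<or> H' \<delta> (t powr g)" using one by blast
    have "\<forall>\<^sub>F t in at_top. H' \<delta> (t powr g)" if "\<forall>\<^sub>F t in at_top. \<not> H \<gamma> t"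
      using that g(2) by eventually_elim blast
    then show "\<gamma> \<in> {\<gamma>. \<exists>\<^sub>F t in at_top. H \<gamma> t} \<or> \<delta> \<in> {\<delta>. \<forall>\<^sub>F t in at_top. H' \<delta> t}"
      using eventually_powr_at_top_iff[OF g(1), of "H' \<delta>"] by (auto simp: frequently_def)
  qed (use neg neg' in auto)
  \<comment> \<open>The quantifiers are exchanged between the two systems, so it is now frequent
    solvability of the transposed system that is carried along the substitution.\<close>
  moreover have "product_one (Sup (ereal ` {\<gamma>. \<forall>\<^sub>F t in at_top. H \<gamma> t})) (Sup (ereal ` {\<delta>. \<exists>\<^sub>F t in at_top. H' \<delta> t}))"
  proof (rule product_one_Sup)
    fix \<gamma> \<delta> :: real assume *: "\<gamma> \<in> {\<gamma>. \<forall>\<^sub>F t in at_top. H \<gamma> t}" "\<delta> \<in> {\<delta>. \<exists>\<^sub>F t in at_top. H' \<delta> t}" "0 < \<gamma>" "0 < \<delta>"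
    show "\<gamma> * \<delta> \<le> 1"
    proof (rule ccontr)
      assume "\<not> \<gamma> * \<delta> \<le> 1"
      then obtain g where g: "0 < g" "\<forall>\<^sub>F t in at_top. \<not> (H \<gamma> t \<and> H' \<delta> (t powr g))"
        using not_both * by (meson not_le)
      have "\<forall>\<^sub>F t in at_top. H \<gamma> t" using * by simp
      with g(2) have "\<forall>\<^sub>F t in at_top. \<not> H' \<delta> (t powr g)" by eventually_elim blast
      then show False using * frequently_powr_at_top_iff[OF g(1), of "H' \<delta>"] by (simp add: frequently_def)
    qed
  next
    fix \<gamma> \<delta> :: real assume *: "0 < \<gamma>" "0 < \<delta>" "\<gamma> * \<delta> < 1"
    then obtain g where g: "0 < g" "\<forall>\<^sub>F t in at_top. H \<gamma> t \<or> H' \<delta> (t powr g)" using one by blast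
    have "\<forall>\<^sub>F t in at_top. H \<gamma> t" if "\<forall>\<^sub>F t in at_top. \<not> H' \<delta> (t powr g)"
      using that g(2) by eventually_elim blast
    then show "\<gamma> \<in> {\<gamma>. \<forall>\<^sub>F t in at_top. H \<gamma> t} \<or> \<delta> \<in> {\<delta>. \<exists>\<^sub>F t in at_top. H' \<delta> t}"
      using frequently_powr_at_top_iff[OF g(1), of "H' \<delta>"] by (auto simp: frequently_def)
  qed (use neg neg' in auto)
  ultimately show ?thesis
    unfolding omega_exp_def omega_hat_exp_def H_def H'_def k'_def by (simp add: image_Collect)
qed

end
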